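(* Let $\eta>0$ be real and let $C\sim\operatorname{LKJ}_n(\eta)$. Then any two distinct off-diagonal entries $C_{ij}$ and $C_{kl}$ (with $i\ne j$, $k\neq l$, $\{i,j\}\neq\{k,l\}$) are independent random variables. In particular this holds for the uniform distribution on $\mathcal{E}_n$ (the case $\eta=1$).
   Context: $\mathcal{E}_n=\{C\in\mathbb{R}^{n\times n}: C=C',\ C\succeq 0,\ C_{ii}=1 \text{ for all } i\}$ is the set of $n\times n$ correlation matrices, identified with a subset of $\mathbb{R}^{d}$, $d=n(n-1)/2$, via the off-diagonal coordinates $(C_{ij})_{i<j}$ and equipped with $d$-dimensional Lebesgue measure. For real $\eta>0$, $\operatorname{LKJ}_n(\eta)$ is the probability distribution on $\mathcal{E}_n$ whose density with respect to this Lebesgue measure is proportional to $\det(C)^{\eta-1}$. *)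

theory Defs
  imports
    "HOL-Probability.Probability"
    "HOL-Analysis.Embed_Measure"
    "Jordan_Normal_Form.Determinant"
begin

definition psd_mat :: "nat \<Rightarrow> real mat \<Rightarrow> bool" where
  "psd_mat n C \<longleftrightarrow>
     C \<in> carrier_mat n n \<and> (\<forall>v \<in> carrier_vec n. 0 \<le> scalar_prod v (C *\<^sub>v v))"

definition corr_mats :: "nat \<Rightarrow> real mat set" where
  "corr_mats n = {C \<in> carrier_mat n n.
     transpose_mat C = C \<and> psd_mat n C \<and> (\<forall>i<n. C $$ (i, i) = 1)}"

text \<open>
  Rows and columns are numbered from 0, as in the matrix library. The coordinate space
  of dimension n(n-1)/2 consists of the functions that are extensional on the
  index pairs (i, j) with i < j < n.
\<close>

definition offdiag :: "nat \<Rightarrow> (nat \<times> nat) set" where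
  "offdiag n = {(i, j). i < j \<and> j < n}"

definition corr_of_coords :: "nat \<Rightarrow> (nat \<times> nat \<Rightarrow> real) \<Rightarrow> real mat" where
  "corr_of_coords n x = Matrix.mat n n
     (\<lambda>(i, j). if i = j then 1 else if i < j then x (i, j) else x (j, i))"

definition coords_lborel :: "nat \<Rightarrow> (nat \<times> nat \<Rightarrow> real) measure" where
  "coords_lborel n = Pi\<^sub>M (offdiag n) (\<lambda>_. lborel)"

text \<open>
  Lebesgue measure on the set of correlation matrices: Lebesgue measure restricted to the
  set of coordinate tuples of correlation matrices, carried over to matrices along the
  injection corr_of_coords.
\<close>

definition corr_lborel :: "nat \<Rightarrow> real mat measure" where
  "corr_lborel n = embed_measure
     (restrict_space (coords_lborel n) {x. corr_of_coords n x \<in> corr_mats n})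
     (corr_of_coords n)"

text \<open>
  On correlation matrices the determinant is nonnegative. It vanishes only on a null set,
  so the convention 0 powr a = 0 does not affect the measure.
\<close>

definition LKJ :: "nat \<Rightarrow> real \<Rightarrow> real mat measure" where
  "LKJ n \<eta> = density (corr_lborel n)
     (\<lambda>C. ennreal (Determinant.det C powr (\<eta> - 1)) /
          (\<integral>\<^sup>+ C. ennreal (Determinant.det C powr (\<eta> - 1)) \<partial>corr_lborel n))"

definition corr_uniform :: "nat \<Rightarrow> real mat measure" where
  "corr_uniform n = uniform_measure (corr_lborel n) (corr_mats n)"

lemma inj_on_corr_of_coords: "inj_on (corr_of_coords n) (space (coords_lborel n))"
proof (rule inj_onI)
  fix x y assume x: "x \<in> space (coords_lborel n)" and y: "y \<in> space (coords_lborel n)"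
    and eq: "corr_of_coords n x = corr_of_coords n y"
  have "x p = y p" if mem: "p \<in> offdiag n" for p
  proof -
    obtain i j where p: "p = (i, j)" "i < j" "j < n"
      using mem by (cases p) (auto simp: offdiag_def)
    have "corr_of_coords n x $$ (i, j) = corr_of_coords n y $$ (i, j)"
      using eq by simp
    then show ?thesis using p by (simp add: corr_of_coords_def)
  qed
  then show "x = y"
    using x y by (auto simp: coords_lborel_def space_PiM intro: PiE_ext)
qed

lemma space_corr_lborel: "space (corr_lborel n) = corr_mats n"
proof -
  have "C \<in> corr_of_coords n ` (space (coords_lborel n) \<inter> {x. corr_of_coords n x \<in> corr_mats n})"
    if C: "C \<in> corr_mats n" for C
  proof -
    define x where "x = restrict (\<lambda>p. C $$ p) (offdiag n)"
    have [simp]: "dim_row C = n" "dim_col C = n" and tr: "transpose_mat C = C"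
      and dg: "\<And>i. i < n \<Longrightarrow> C $$ (i, i) = 1"
      using C by (auto simp: corr_mats_def)
    have sym: "C $$ (j, i) = C $$ (i, j)" if "i < n" "j < n" for i j
      using that index_transpose_mat(1)[of i C j] tr by simp
    have "corr_of_coords n x = C"
      by (rule eq_matI) (auto simp: corr_of_coords_def x_def offdiag_def dg sym)
    moreover have "x \<in> space (coords_lborel n)"
      by (auto simp: x_def coords_lborel_def space_PiM)
    ultimately show ?thesis using C by blast
  qed
  then show ?thesis
    by (auto simp: corr_lborel_def space_embed_measure space_restrict_space)
qed

end

theory Submission
  imports Defs
begin

text \<open>
  Choose the names so that $j$ is neither $k$ nor $l$. For fixed $a = C_{ij}$ with
  $|a| < 1$ put $s = \sqrt{1 - a^2}$ and let $M$ be the identity matrix with row $j$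
  replaced by $a e_i + s e_j$. Every correlation matrix with $C_{ij} = a$ is $M N M^T$ for
  a unique correlation matrix $N$ with $N_{ij} = 0$, and $N$ agrees with $C$ outside row and
  column $j$. In the remaining coordinates the map from $N$ to $C$ is affine with Jacobian
  $s^{n-2}$, and $\det C = s^2 \det N$. So the joint law of $C_{ij}$ and $N$ has a product
  density, and $C_{kl} = N_{kl}$ is a function of $N$. The normalising constant is never
  computed: total mass 1 is all that is used of it.
\<close>

section \<open>Coordinates indexed by unordered pairs\<close>

text \<open>Coordinates live on increasing pairs only. Sorting the two indices addresses an entry
  without knowing which index is smaller, so rows and columns are treated alike.\<close>

definition upair :: "nat \<Rightarrow> nat \<Rightarrow> nat \<times> nat" where
  "upair u v = (min u v, max u v)"

lemma upair_commute: "upair u v = upair v u"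
  by (simp add: upair_def min.commute max.commute)

lemma upair_eq_iff: "upair u v = upair p q \<longleftrightarrow> u = p \<and> v = q \<or> u = q \<and> v = p"
  by (auto simp: upair_def min_def max_def split: if_splits)

lemma upair_endpoint_iff: "fst (upair u v) = j \<or> snd (upair u v) = j \<longleftrightarrow> u = j \<or> v = j"
  by (auto simp: upair_def min_def max_def)

lemma upair_in_offdiag: "u \<noteq> v \<Longrightarrow> u < n \<Longrightarrow> v < n \<Longrightarrow> upair u v \<in> offdiag n"
  by (auto simp: upair_def offdiag_def)

lemma finite_offdiag [simp]: "finite (offdiag n)"
  by (rule finite_subset[of _ "{..<n} \<times> {..<n}"]) (auto simp: offdiag_def)

lemma corr_of_coords_carrier [simp]: "corr_of_coords n x \<in> carrier_mat n n"
  by (simp add: corr_of_coords_def)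

lemma corr_of_coords_dim [simp]:
  "dim_row (corr_of_coords n x) = n" "dim_col (corr_of_coords n x) = n"
  by (simp_all add: corr_of_coords_def)

lemma corr_of_coords_index:
  assumes "u < n" "v < n"
  shows "corr_of_coords n x $$ (u, v) = (if u = v then 1 else x (upair u v))"
  using assms by (auto simp: corr_of_coords_def upair_def)

text \<open>Symmetry and the unit diagonal are built into the coordinates, so semidefiniteness is
  the only condition left.\<close>

lemma corr_of_coords_in_corr_mats_iff:
  "corr_of_coords n x \<in> corr_mats n \<longleftrightarrow> psd_mat n (corr_of_coords n x)"
proof -
  have "transpose_mat (corr_of_coords n x) = corr_of_coords n x"
    by (rule eq_matI) (simp_all add: corr_of_coords_index upair_commute)
  then show ?thesis
    by (simp add: corr_mats_def corr_of_coords_index)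
qed

subsection \<open>Congruence by a row operation\<close>

text \<open>The quadratic form of the product at \<open>v\<close> is the form of \<open>N\<close> at
  \<open>w\<close>, the image of \<open>v\<close> under the transpose of \<open>M\<close>.\<close>

lemma psd_mat_congruence:
  assumes "psd_mat n N" and M: "M \<in> carrier_mat n n"
  shows "psd_mat n (M * N * transpose_mat M)"
  unfolding psd_mat_def
proof (intro conjI ballI)
  have N: "N \<in> carrier_mat n n" using assms(1) by (simp add: psd_mat_def)
  then show "M * N * transpose_mat M \<in> carrier_mat n n" using M by simp
  fix v :: "real vec" assume v: "v \<in> carrier_vec n"
  define w where "w = transpose_mat M *\<^sub>v v"
  have w: "w \<in> carrier_vec n" using M v by (simp add: w_def)
  have "(M * N * transpose_mat M) *\<^sub>v v = (M * N) *\<^sub>v w"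
    unfolding w_def by (rule assoc_mult_mat_vec) (use M N v in auto)
  also have "\<dots> = M *\<^sub>v (N *\<^sub>v w)"
    by (rule assoc_mult_mat_vec) (use M N w in auto)
  finally have "(M * N * transpose_mat M) *\<^sub>v v = M *\<^sub>v (N *\<^sub>v w)" .
  moreover have "v \<bullet> (M *\<^sub>v (N *\<^sub>v w)) = w \<bullet> (N *\<^sub>v w)"
    unfolding w_def
    by (rule transpose_vec_mult_scalar[symmetric]) (use M N v in auto)
  moreover have "0 \<le> w \<bullet> (N *\<^sub>v w)" using assms(1) w by (simp add: psd_mat_def)
  ultimately show "0 \<le> v \<bullet> ((M * N * transpose_mat M) *\<^sub>v v)" by simp
qed

text \<open>For the converse, congruence by the inverse \<open>B\<close> of \<open>M\<close>
  recovers \<open>N\<close>.\<close>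

lemma psd_mat_congruence_iff:
  assumes N: "N \<in> carrier_mat n n" and M: "M \<in> carrier_mat n n" and "Determinant.det M \<noteq> 0"
  shows "psd_mat n (M * N * transpose_mat M) \<longleftrightarrow> psd_mat n N"
proof
  assume *: "psd_mat n (M * N * transpose_mat M)"
  from det_non_zero_imp_unit[OF M assms(3), of "()"]
  obtain B where B: "B \<in> carrier_mat n n" and BM: "B * M = 1\<^sub>m n"
    unfolding Units_def ring_mat_def by auto
  have "transpose_mat M * transpose_mat B = 1\<^sub>m n"
    using transpose_mult[OF B M] BM by simp
  moreover have "B * (M * N * transpose_mat M) * transpose_mat B =
      (B * M) * N * (transpose_mat M * transpose_mat B)"
    using B M N by (simp add: assoc_mult_mat[of _ n n _ n _ n])
  ultimately have "B * (M * N * transpose_mat M) * transpose_mat B = N"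
    using N BM by simp
  with psd_mat_congruence[OF * B] show "psd_mat n N" by simp
qed (rule psd_mat_congruence[OF _ M])

text \<open>Left multiplication by \<open>M\<close> replaces row \<open>j\<close> by
  \<open>a\<close> times row \<open>i\<close> plus \<open>s\<close> times row \<open>j\<close>;
  right multiplication by the transpose does the same to the columns. Since \<open>x\<close>
  vanishes at the pair of \<open>i\<close> and \<open>j\<close>, the new entry there is
  \<open>a\<close>.\<close>

lemma corr_of_coords_shear:
  fixes x y :: "nat \<times> nat \<Rightarrow> real"
  assumes ij: "i < n" "j < n" "i \<noteq> j" and s: "s\<^sup>2 = 1 - a\<^sup>2"
    and "x (upair i j) = 0" and "y (upair i j) = a"
    and row: "\<And>m. m < n \<Longrightarrow> m \<noteq> i \<Longrightarrow> m \<noteq> j \<Longrightarrow> y (upair j m) = a * x (upair i m) + s * x (upair j m)"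
    and rest: "\<And>u v. u < n \<Longrightarrow> v < n \<Longrightarrow> u \<noteq> v \<Longrightarrow> u \<noteq> j \<Longrightarrow> v \<noteq> j \<Longrightarrow> y (upair u v) = x (upair u v)"
  defines "M \<equiv> addrow_mat n a j i * multrow_mat n j s"
  shows "corr_of_coords n y = M * corr_of_coords n x * transpose_mat M"
proof -
  have M: "M \<in> carrier_mat n n" unfolding M_def by (rule mult_carrier_mat) auto
  have M_mult: "M * N = addrow a j i (multrow j s N)" if "N \<in> carrier_mat n n" for N
  proof -
    have c: "multrow_mat n j s * N \<in> carrier_mat n n" using that by auto
    have "M * N = addrow_mat n a j i * (multrow_mat n j s * N)"
      unfolding M_def using that by (intro assoc_mult_mat) auto
    also have "\<dots> = addrow a j i (multrow j s N)"
      using addrow_mat[OF c, of i a j] multrow_mat[OF that, of j s] ij by simp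
    finally show ?thesis .
  qed
  define X where "X = M * corr_of_coords n x"
  have X: "X \<in> carrier_mat n n" unfolding X_def using M by simp
  have X_eq: "X = addrow a j i (multrow j s (corr_of_coords n x))"
    unfolding X_def by (rule M_mult) simp
  \<comment> \<open>Two transpositions turn the column operation into a row operation, so
    \<open>M_mult\<close> applies a second time.\<close>
  have "X * transpose_mat M = transpose_mat (M * transpose_mat X)"
    using transpose_mult[OF M, of "transpose_mat X" n] X by simp
  also have "\<dots> = transpose_mat (addrow a j i (multrow j s (transpose_mat X)))"
    using X by (subst M_mult) auto
  also have "\<dots> = corr_of_coords n y"
  proof (rule eq_matI)
    fix u v assume "u < dim_row (corr_of_coords n y)" "v < dim_col (corr_of_coords n y)"
    then have uv: "u < n" "v < n" by simp_all
    have sym: "x (upair j i) = 0" "y (upair j i) = a" "x (upair i j) = 0" "y (upair i j) = a"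
      using assms(5,6) by (simp_all add: upair_commute[of j i])
    have rev: "y (upair m j) = a * x (upair i m) + s * x (upair j m)" "x (upair m j) = x (upair j m)"
      "x (upair m i) = x (upair i m)" "y (upair m i) = x (upair i m)"
      if "m < n" "m \<noteq> i" "m \<noteq> j" for m
      using row[OF that] rest[of m i] that ij
      by (simp_all add: upair_commute[of m j] upair_commute[of m i])
    \<comment> \<open>This is the new diagonal entry at \<open>(j, j)\<close>: the cross terms
      contain the factor \<open>x (upair i j) = 0\<close>, and the choice of \<open>s\<close> keeps
      the entry equal to 1.\<close>
    have sq: "a * a + s * s = 1" using s by (simp add: power2_eq_square)
    show "transpose_mat (addrow a j i (multrow j s (transpose_mat X))) $$ (u, v) =
        corr_of_coords n y $$ (u, v)"
    proof (cases "u = j"; cases "v = j")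
      assume "u = j" "v = j"
      then show ?thesis
        using uv ij sq by (simp add: X_eq corr_of_coords_index sym algebra_simps)
    next
      assume "u = j" "v \<noteq> j"
      then show ?thesis
        using uv ij row[of v]
        by (cases "v = i") (simp_all add: X_eq corr_of_coords_index sym)
    next
      assume "u \<noteq> j" "v = j"
      then show ?thesis
        using uv ij rev[of u]
        by (cases "u = i") (simp_all add: X_eq corr_of_coords_index sym)
    next
      assume "u \<noteq> j" "v \<noteq> j"
      then show ?thesis
        using uv ij rest[of u v] by (simp add: X_eq corr_of_coords_index)
    qed
  qed (use X in auto)
  finally show ?thesis by (simp add: X_def)
qed

text \<open>The shear matrix has determinant \<open>s\<close>. Hence it is invertible, congruence by
  it preserves semidefiniteness both ways, and it and its transpose each contribute a factor
  \<open>s\<close> to the determinant.\<close>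

lemma corr_of_coords_shear_psd_det:
  fixes x y :: "nat \<times> nat \<Rightarrow> real"
  assumes "i < n" "j < n" "i \<noteq> j" and "s\<^sup>2 = 1 - a\<^sup>2" and "s \<noteq> 0"
    and "x (upair i j) = 0" and "y (upair i j) = a"
    and "\<And>m. m < n \<Longrightarrow> m \<noteq> i \<Longrightarrow> m \<noteq> j \<Longrightarrow> y (upair j m) = a * x (upair i m) + s * x (upair j m)"
    and "\<And>u v. u < n \<Longrightarrow> v < n \<Longrightarrow> u \<noteq> v \<Longrightarrow> u \<noteq> j \<Longrightarrow> v \<noteq> j \<Longrightarrow> y (upair u v) = x (upair u v)"
  shows "psd_mat n (corr_of_coords n y) \<longleftrightarrow> psd_mat n (corr_of_coords n x)"
    and "Determinant.det (corr_of_coords n y) = s\<^sup>2 * Determinant.det (corr_of_coords n x)"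
proof -
  define M where "M = addrow_mat n a j i * multrow_mat n j s"
  have M: "M \<in> carrier_mat n n" unfolding M_def by (rule mult_carrier_mat) auto
  have eq: "corr_of_coords n y = M * corr_of_coords n x * transpose_mat M"
    unfolding M_def by (rule corr_of_coords_shear) (use assms in auto)
  have det: "Determinant.det M = s"
    unfolding M_def using assms(1-3)
    by (subst det_mult[of _ n]) (simp_all add: det_addrow_mat det_multrow_mat)
  show "psd_mat n (corr_of_coords n y) \<longleftrightarrow> psd_mat n (corr_of_coords n x)"
    unfolding eq by (rule psd_mat_congruence_iff) (use M det assms in auto)
  have "Determinant.det (M * corr_of_coords n x * transpose_mat M) = s * Determinant.det (corr_of_coords n x) * s"
    using M by (simp add: det_mult[of _ n] det_transpose det)
  then show "Determinant.det (corr_of_coords n y) = s\<^sup>2 * Determinant.det (corr_of_coords n x)"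
    by (simp add: eq power2_eq_square)
qed

section \<open>Quadratic forms and the bound on the entries\<close>

text \<open>Double sums over functions suit the finitely supported test vectors and the limits used
  below.\<close>

lemma psd_mat_quadratic_form:
  assumes "C \<in> carrier_mat n n"
  shows "psd_mat n C \<longleftrightarrow>
    (\<forall>f. 0 \<le> (\<Sum>r<n. \<Sum>c<n. f r * C $$ (r, c) * f c))"
proof -
  have *: "v \<bullet> (C *\<^sub>v v) = (\<Sum>r<n. \<Sum>c<n. v $ r * C $$ (r, c) * v $ c)"
    if "v \<in> carrier_vec n" for v
    using assms that
    by (auto simp: scalar_prod_def sum_distrib_left atLeast0LessThan mult.assoc
        intro!: sum.cong)
  have "0 \<le> (\<Sum>r<n. \<Sum>c<n. f r * C $$ (r, c) * f c)" if "psd_mat n C" for f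
  proof -
    have "0 \<le> vec n f \<bullet> (C *\<^sub>v vec n f)" using that by (simp add: psd_mat_def)
    then show ?thesis by (simp add: *)
  qed
  then show ?thesis using assms by (auto simp: psd_mat_def *)
qed

text \<open>The test vector e_j - a e_i, with a the entry in question, gives the value 1 - a^2.
  Hence slices with |a| > 1 contain no correlation matrix.\<close>

lemma psd_mat_corr_entry_bound:
  assumes "psd_mat n (corr_of_coords n x)" and ij: "i < n" "j < n" "i \<noteq> j"
  shows "\<bar>x (upair i j)\<bar> \<le> 1"
proof -
  let ?a = "x (upair i j)"
  let ?C = "corr_of_coords n x"
  define f where "f = (\<lambda>r. if r = j then 1 else if r = i then - ?a else 0)"
  have "(\<Sum>c<n. f r * ?C $$ (r, c) * f c) = (\<Sum>c\<in>{i, j}. f r * ?C $$ (r, c) * f c)" for r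
    by (rule sum.mono_neutral_right) (use ij in \<open>auto simp: f_def\<close>)
  then have "(\<Sum>r<n. \<Sum>c<n. f r * ?C $$ (r, c) * f c) =
      (\<Sum>r<n. \<Sum>c\<in>{i, j}. f r * ?C $$ (r, c) * f c)"
    by simp
  also have "\<dots> = (\<Sum>r\<in>{i, j}. \<Sum>c\<in>{i, j}. f r * ?C $$ (r, c) * f c)"
    by (rule sum.mono_neutral_right) (use ij in \<open>auto simp: f_def\<close>)
  also have "\<dots> = 1 - ?a\<^sup>2"
    using ij by (simp add: f_def corr_of_coords_index upair_commute[of j i] power2_eq_square)
  finally have "0 \<le> 1 - ?a\<^sup>2"
    using assms(1) unfolding psd_mat_quadratic_form[OF corr_of_coords_carrier]
    by (elim allE[of _ f]) simp
  then show ?thesis by (simp add: abs_square_le_1)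
qed

subsection \<open>Measurability\<close>

text \<open>Scaling and rounding replace an arbitrary vector by integer vectors, of which there
  are only countably many.\<close>

lemma psd_mat_integer_vectors:
  assumes "C \<in> carrier_mat n n"
  shows "psd_mat n C \<longleftrightarrow>
    (\<forall>xs :: int list. 0 \<le> (\<Sum>r<n. \<Sum>c<n. of_int (xs ! r) * C $$ (r, c) * of_int (xs ! c)))"
    (is "_ \<longleftrightarrow> ?R")
proof
  assume ?R
  define Q where "Q f = (\<Sum>r<n. \<Sum>c<n. f r * C $$ (r, c) * f c)" for f
  have "0 \<le> Q f" for f
  proof (rule tendsto_lowerbound)
    let ?g = "\<lambda>m r. of_int \<lfloor>real m * f r\<rfloor> / real m"
    have lim: "(\<lambda>m. ?g m r) \<longlonglongrightarrow> f r" for r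
    proof (rule tendsto_sandwich)
      show "\<forall>\<^sub>F m in sequentially. f r - inverse (real m) \<le> ?g m r"
        using eventually_gt_at_top[of 0]
      proof eventually_elim
        case (elim m)
        have "(real m * f r - 1) / real m \<le> ?g m r"
          by (intro divide_right_mono) linarith+
        then show ?case using elim by (simp add: diff_divide_distrib inverse_eq_divide)
      qed
      show "\<forall>\<^sub>F m in sequentially. ?g m r \<le> f r"
        using eventually_gt_at_top[of 0]
        by eventually_elim (simp add: field_simps)
      show "(\<lambda>m. f r - inverse (real m)) \<longlonglongrightarrow> f r"
        using tendsto_diff[OF tendsto_const lim_inverse_n] by simp
    qed simp
    show "(\<lambda>m. Q (?g m)) \<longlonglongrightarrow> Q f"
      unfolding Q_def by (intro tendsto_intros lim)
    \<comment> \<open>The form is homogeneous of degree 2, so the denominators come out as the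
      square of \<open>m\<close>. At \<open>m = 0\<close> both sides are 0, since division by 0
      yields 0.\<close>
    have "0 \<le> Q (?g m)" for m
    proof -
      define xs where "xs = map (\<lambda>r. \<lfloor>real m * f r\<rfloor>) [0..<n]"
      have "Q (?g m) =
          (\<Sum>r<n. \<Sum>c<n. of_int (xs ! r) * C $$ (r, c) * of_int (xs ! c)) / (real m)\<^sup>2"
        by (simp add: Q_def xs_def sum_divide_distrib power2_eq_square)
      then show ?thesis using \<open>?R\<close> by simp
    qed
    then show "\<forall>\<^sub>F m in sequentially. 0 \<le> Q (?g m)" by simp
  qed simp
  then show "psd_mat n C" using assms by (simp add: psd_mat_quadratic_form Q_def)
\<comment> \<open>Beyond the end of a short list \<open>xs ! r\<close> is unspecified but still an
  integer, so every list gives an instance of the quadratic form criterion.\<close>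
qed (use assms in \<open>simp add: psd_mat_quadratic_form\<close>)

lemma corr_of_coords_entry_measurable:
  assumes "u < n" "v < n"
  shows "(\<lambda>x. corr_of_coords n x $$ (u, v)) \<in> borel_measurable (coords_lborel n)"
proof (cases "u = v")
  case False
  have "(\<lambda>x. x (upair u v)) \<in> borel_measurable (coords_lborel n)"
    unfolding coords_lborel_def using upair_in_offdiag[OF False assms] by measurable
  then show ?thesis using False assms by (simp add: corr_of_coords_index)
qed (use assms in \<open>simp add: corr_of_coords_index\<close>)

text \<open>By the Leibniz formula the determinant is a polynomial in the entries; permutations keep
  the indices below \<open>n\<close>.\<close>

lemma corr_of_coords_det_measurable:
  "(\<lambda>x. Determinant.det (corr_of_coords n x)) \<in> borel_measurable (coords_lborel n)"
proof -
  have "p i < n" if "p permutes {0..<n}" "i < n" for p i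
    using permutes_in_image[OF that(1), of i] that by simp
  then show ?thesis
    unfolding det_def'[OF corr_of_coords_carrier]
    by (intro borel_measurable_sum borel_measurable_times borel_measurable_prod
        borel_measurable_const corr_of_coords_entry_measurable) auto
qed

text \<open>Integer lists are countable, so the criterion by integer vectors gives a countable
  intersection of measurable sets.\<close>

lemma corr_of_coords_psd_measurable:
  "{x \<in> space (coords_lborel n). psd_mat n (corr_of_coords n x)} \<in> sets (coords_lborel n)"
proof -
  have [measurable]: "(\<lambda>x. \<Sum>r<n. \<Sum>c<n. of_int (xs ! r) * corr_of_coords n x $$ (r, c) * of_int (xs ! c))
      \<in> borel_measurable (coords_lborel n)" for xs :: "int list"
    by (intro borel_measurable_sum borel_measurable_times borel_measurable_const
        corr_of_coords_entry_measurable) auto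
  show ?thesis
    unfolding psd_mat_integer_vectors[OF corr_of_coords_carrier] by measurable
qed

subsection \<open>Integration\<close>

interpretation lborel_PiM: product_sigma_finite "\<lambda>_. lborel :: real measure"
  by standard

text \<open>Fubini splits off one coordinate at a time, and each one-dimensional substitution
  contributes a factor \<open>s\<close>. The shift \<open>c\<close> may vary with the coordinate; in
  the application it carries frozen entries of row i.\<close>

lemma nn_integral_PiM_lborel_affine:
  fixes f :: "('i \<Rightarrow> real) \<Rightarrow> ennreal"
  assumes "finite J" and "s > 0" and "f \<in> borel_measurable (Pi\<^sub>M J (\<lambda>_. lborel))"
  shows "(\<integral>\<^sup>+ y. f y \<partial>Pi\<^sub>M J (\<lambda>_. lborel)) =
    ennreal (s ^ card J) * (\<integral>\<^sup>+ z. f (\<lambda>p\<in>J. c p + s * z p) \<partial>Pi\<^sub>M J (\<lambda>_. lborel))"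
  using assms(1,3)
proof (induction J arbitrary: f)
  case empty
  then show ?case by (simp add: PiM_empty nn_integral_count_space_finite restrict_def)
next
  case (insert p J)
  let ?P = "\<lambda>J. Pi\<^sub>M J (\<lambda>_. lborel :: real measure)"
  note [measurable] = insert.prems
  have upd: "(\<lambda>y. f (y(p := t))) \<in> borel_measurable (?P J)" for t
    by measurable
  have upd': "(\<lambda>t. f (y(p := t))) \<in> borel_measurable borel" if "y \<in> space (?P J)" for y
    using measurable_compose[OF measurable_component_update[OF that insert.hyps(2)] insert.prems]
    by (simp only: measurable_lborel2)
  have aff: "(\<lambda>z. \<lambda>q\<in>K. c q + s * z q) \<in> ?P K \<rightarrow>\<^sub>M ?P K" for K
    by measurable
  have eq: "(\<lambda>q\<in>insert p J. c q + s * (z(p := t)) q) = (\<lambda>q\<in>J. c q + s * z q)(p := c p + s * t)" for z t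
    using insert.hyps(2) by (auto simp: fun_eq_iff)
  have "(\<integral>\<^sup>+ y. f y \<partial>?P (insert p J)) = (\<integral>\<^sup>+ y. \<integral>\<^sup>+ t. f (y(p := t)) \<partial>lborel \<partial>?P J)"
    using insert.hyps insert.prems by (rule lborel_PiM.product_nn_integral_insert)
  also have "\<dots> = (\<integral>\<^sup>+ y. ennreal s * (\<integral>\<^sup>+ t. f (y(p := c p + s * t)) \<partial>lborel) \<partial>?P J)"
    using assms(2) upd'
    by (intro nn_integral_cong) (subst nn_integral_real_affine[where c = s and t = "c p"], auto)
  also have "\<dots> = ennreal s * (\<integral>\<^sup>+ y. \<integral>\<^sup>+ t. f (y(p := c p + s * t)) \<partial>lborel \<partial>?P J)"
    by (intro nn_integral_cmult) measurable
  \<comment> \<open>The induction hypothesis is applied to the partial integral over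
    \<open>t\<close> as a function of the remaining coordinates, hence the generalisation over
    \<open>f\<close>.\<close>
  also have "(\<integral>\<^sup>+ y. \<integral>\<^sup>+ t. f (y(p := c p + s * t)) \<partial>lborel \<partial>?P J) =
     ennreal (s ^ card J) * (\<integral>\<^sup>+ z. \<integral>\<^sup>+ t. f ((\<lambda>q\<in>J. c q + s * z q)(p := c p + s * t)) \<partial>lborel \<partial>?P J)"
    by (intro insert.IH) measurable
  also have "(\<integral>\<^sup>+ z. \<integral>\<^sup>+ t. f ((\<lambda>q\<in>J. c q + s * z q)(p := c p + s * t)) \<partial>lborel \<partial>?P J) =
     (\<integral>\<^sup>+ z. f (\<lambda>q\<in>insert p J. c q + s * z q) \<partial>?P (insert p J))"
    unfolding eq[symmetric]
    by (rule lborel_PiM.product_nn_integral_insert[symmetric])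
      (use insert.hyps measurable_compose[OF aff insert.prems] in auto)
  finally have "(\<integral>\<^sup>+ y. f y \<partial>?P (insert p J)) = ennreal s * (ennreal (s ^ card J) *
      (\<integral>\<^sup>+ z. f (\<lambda>q\<in>insert p J. c q + s * z q) \<partial>?P (insert p J)))" .
  moreover have "ennreal (s ^ card (insert p J)) = ennreal s * ennreal (s ^ card J)"
    using insert.hyps assms(2) by (simp add: ennreal_mult)
  ultimately show ?case by (simp only: mult.assoc)
qed


section \<open>Change of variables between slices\<close>

text \<open>The shear carries the slice at 0 to the slice at \<open>a\<close>. Its Jacobian is
  \<open>s ^ card J\<close>, and \<open>h s\<close> is the response of the weight to the factor s^2
  in the determinant. As \<open>k\<close> and \<open>l\<close> differ from \<open>j\<close>, the
  entry tested by \<open>B\<close> does not move.\<close>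

lemma nn_integral_corr_row_shear:
  fixes w h :: "real \<Rightarrow> ennreal"
  assumes ij: "i < n" "j < n" "i \<noteq> j" and kl: "k < n" "l < n" "k \<noteq> l" "k \<noteq> j" "l \<noteq> j"
    and s: "s > 0" "s\<^sup>2 = 1 - a\<^sup>2"
    and w_scale: "\<And>d. w (s\<^sup>2 * d) = h s * w d"
    and F_def: "F = (\<lambda>x. if psd_mat n (corr_of_coords n x)
                 then w (Determinant.det (corr_of_coords n x)) else 0)"
    and F [measurable]: "F \<in> borel_measurable (Pi\<^sub>M (offdiag n) (\<lambda>_. lborel))"
    and [measurable]: "B \<in> sets borel"
  defines "K \<equiv> offdiag n - {upair i j}"
  defines "J \<equiv> {p \<in> K. fst p = j \<or> snd p = j}"
  shows "(\<integral>\<^sup>+ x. F (x(upair i j := a)) * indicator B (x (upair k l)) \<partial>Pi\<^sub>M K (\<lambda>_. lborel)) =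
     ennreal (s ^ card J) * h s *
     (\<integral>\<^sup>+ x. F (x(upair i j := 0)) * indicator B (x (upair k l)) \<partial>Pi\<^sub>M K (\<lambda>_. lborel))"
proof -
  let ?P = "\<lambda>J. Pi\<^sub>M J (\<lambda>_. lborel :: real measure)"
  \<comment> \<open>\<open>J\<close> consists of the coordinates in row or column \<open>j\<close>
    that get rescaled, \<open>R\<close> of those that the shear leaves alone.\<close>
  define R where "R = K - J"
  define \<Phi> where "\<Phi> t x = F (x(upair i j := t)) * indicator B (x (upair k l))" for t x
  \<comment> \<open>The conditional selects the endpoint m of \<open>p\<close> other than
    \<open>j\<close>; the shift is \<open>a\<close> times the entry at i and m. For \<open>p\<close>
    in \<open>J\<close> that entry lies in \<open>R\<close>, so it is constant while
    \<open>z\<close> varies.\<close>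
  define c where "c r p = a * r (upair i (if fst p = j then snd p else fst p))"
    for r :: "nat \<times> nat \<Rightarrow> real" and p
  define y where "y r z = merge R J (r, \<lambda>p\<in>J. c r p + s * z p)" for r z
  have e: "insert (upair i j) K = offdiag n" and K: "finite K" "finite R" "finite J" "R \<inter> J = {}" "R \<union> J = K"
    using upair_in_offdiag[OF ij(3,1,2)] by (auto simp: K_def J_def R_def)
  have row_in: "upair j m \<in> J" "upair j m \<notin> R" if "m < n" "m \<noteq> i" "m \<noteq> j" for m
    using that ij upair_in_offdiag[of j m n]
    by (auto simp: R_def J_def K_def upair_eq_iff upair_endpoint_iff)
  have rest_in: "upair u v \<in> R" "upair u v \<notin> J" "upair u v \<noteq> upair i j"
    if "u < n" "v < n" "u \<noteq> v" "u \<noteq> j" "v \<noteq> j" for u v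
    using that ij upair_in_offdiag[of u v n]
    by (auto simp: R_def J_def K_def upair_eq_iff upair_endpoint_iff)
  have other: "(if fst (upair j m) = j then snd (upair j m) else fst (upair j m)) = m" for m
    by (auto simp: upair_def min_def max_def)
  have [measurable]: "(\<lambda>x. x(upair i j := t)) \<in> ?P K \<rightarrow>\<^sub>M ?P (offdiag n)" for t
    unfolding e[symmetric] by measurable
  have "upair k l \<in> K" using rest_in[of k l] kl K(5) by auto
  then have \<Phi> [measurable]: "\<Phi> t \<in> borel_measurable (?P (R \<union> J))" for t
    unfolding \<Phi>_def K(5) by measurable
  have shear: "\<Phi> a (y r z) = h s * \<Phi> 0 (merge R J (r, z))" for r z
  proof -
    \<comment> \<open>\<open>K\<close> omits the pair of \<open>i\<close> and \<open>j\<close>, so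
      its value is supplied here: 0 for N and \<open>a\<close> for C.\<close>
    let ?x = "(merge R J (r, z))(upair i j := 0)" and ?y = "(y r z)(upair i j := a)"
    have row: "?y (upair j m) = a * ?x (upair i m) + s * ?x (upair j m)" if "m < n" "m \<noteq> i" "m \<noteq> j" for m
      using that ij row_in[of m] rest_in[of i m]
      by (simp add: y_def merge_def c_def other upair_eq_iff)
    have rest: "?y (upair u v) = ?x (upair u v)" if "u < n" "v < n" "u \<noteq> v" "u \<noteq> j" "v \<noteq> j" for u v
      using rest_in[OF that] by (simp add: y_def merge_def)
    have "psd_mat n (corr_of_coords n ?y) \<longleftrightarrow> psd_mat n (corr_of_coords n ?x)"
      by (rule corr_of_coords_shear_psd_det(1)[OF ij s(2)]) (use s(1) row rest in auto)
    moreover have "Determinant.det (corr_of_coords n ?y) = s\<^sup>2 * Determinant.det (corr_of_coords n ?x)"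
      by (rule corr_of_coords_shear_psd_det(2)[OF ij s(2)]) (use s(1) row rest in auto)
    ultimately have "F ?y = h s * F ?x"
      by (simp add: F_def w_scale)
    moreover have "y r z (upair k l) = merge R J (r, z) (upair k l)"
      using rest_in[OF kl] by (simp add: y_def merge_def)
    ultimately show ?thesis by (simp add: \<Phi>_def mult.assoc)
  qed
  \<comment> \<open>The coordinates in \<open>R\<close> are integrated last: for fixed
    \<open>r\<close> the map in \<open>z\<close> is a dilation by \<open>s\<close> with constant
    shift.\<close>
  have "(\<integral>\<^sup>+ x. \<Phi> a x \<partial>?P K) = (\<integral>\<^sup>+ r. \<integral>\<^sup>+ z. \<Phi> a (merge R J (r, z)) \<partial>?P J \<partial>?P R)"
    unfolding K(5)[symmetric] by (rule lborel_PiM.product_nn_integral_fold) (use K in auto)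
  also have "\<dots> = (\<integral>\<^sup>+ r. ennreal (s ^ card J) * (\<integral>\<^sup>+ z. \<Phi> a (y r z) \<partial>?P J) \<partial>?P R)"
  proof (rule nn_integral_cong)
    fix r assume r: "r \<in> space (?P R)"
    have "(\<lambda>z. \<Phi> a (merge R J (r, z))) \<in> borel_measurable (?P J)"
      by (rule measurable_compose[OF measurable_Pair1'[OF r]
            measurable_compose[OF measurable_merge \<Phi>]])
    then show "(\<integral>\<^sup>+ z. \<Phi> a (merge R J (r, z)) \<partial>?P J) =
        ennreal (s ^ card J) * (\<integral>\<^sup>+ z. \<Phi> a (y r z) \<partial>?P J)"
      unfolding y_def using K s(1) by (intro nn_integral_PiM_lborel_affine)
  qed
  also have "\<dots> = (\<integral>\<^sup>+ r. ennreal (s ^ card J) * h s * (\<integral>\<^sup>+ z. \<Phi> 0 (merge R J (r, z)) \<partial>?P J) \<partial>?P R)"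
    unfolding shear
  proof (rule nn_integral_cong)
    fix r assume r: "r \<in> space (?P R)"
    have "(\<lambda>z. \<Phi> 0 (merge R J (r, z))) \<in> borel_measurable (?P J)"
      by (rule measurable_compose[OF measurable_Pair1'[OF r]
            measurable_compose[OF measurable_merge \<Phi>]])
    then show "ennreal (s ^ card J) * (\<integral>\<^sup>+ z. h s * \<Phi> 0 (merge R J (r, z)) \<partial>?P J) =
        ennreal (s ^ card J) * h s * (\<integral>\<^sup>+ z. \<Phi> 0 (merge R J (r, z)) \<partial>?P J)"
      by (simp add: nn_integral_cmult mult.assoc)
  qed
  also have "\<dots> = ennreal (s ^ card J) * h s * (\<integral>\<^sup>+ r. \<integral>\<^sup>+ z. \<Phi> 0 (merge R J (r, z)) \<partial>?P J \<partial>?P R)"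
  proof (intro nn_integral_cmult sigma_finite_measure.borel_measurable_nn_integral)
    show "sigma_finite_measure (?P J)" by (rule lborel_PiM.sigma_finite[OF K(3)])
    show "(\<lambda>(r, z). \<Phi> 0 (merge R J (r, z))) \<in> borel_measurable (?P R \<Otimes>\<^sub>M ?P J)"
      using measurable_compose[OF measurable_merge \<Phi>] by (simp only: case_prod_beta' prod.collapse)
  qed
  also have "(\<integral>\<^sup>+ r. \<integral>\<^sup>+ z. \<Phi> 0 (merge R J (r, z)) \<partial>?P J \<partial>?P R) = (\<integral>\<^sup>+ x. \<Phi> 0 x \<partial>?P K)"
    unfolding K(5)[symmetric]
    by (rule lborel_PiM.product_nn_integral_fold[symmetric]) (use K in auto)
  finally show ?thesis by (simp add: \<Phi>_def)
qed

text \<open>Slicing along the entry at i and j, each slice is a factor depending only on its value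
  a, times the slice at 0, which depends only on \<open>B\<close>. Integrating the factor over
  \<open>A\<close> gives \<open>G A\<close>.\<close>

lemma nn_integral_corr_factorization:
  fixes w h :: "real \<Rightarrow> ennreal"
  assumes ij: "i < n" "j < n" "i \<noteq> j" and kl: "k < n" "l < n" "k \<noteq> l" and ne: "{i, j} \<noteq> {k, l}"
    and [measurable]: "w \<in> borel_measurable borel" "h \<in> borel_measurable borel"
    and w_scale: "\<And>s d. s > 0 \<Longrightarrow> w (s\<^sup>2 * d) = h s * w d"
  obtains G H :: "real set \<Rightarrow> ennreal" where
    "\<And>A B. A \<in> sets borel \<Longrightarrow> B \<in> sets borel \<Longrightarrow>
      (\<integral>\<^sup>+ x. (if psd_mat n (corr_of_coords n x) then
           w (Determinant.det (corr_of_coords n x)) *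
           (indicator A (x (upair i j)) * indicator B (x (upair k l))) else 0) \<partial>coords_lborel n) = G A * H B"
proof -
  \<comment> \<open>The two pairs share at most one index, so one of \<open>i\<close> and
    \<open>j\<close> lies outside the pair of \<open>k\<close> and \<open>l\<close>; it becomes the
    sheared row \<open>j'\<close>.\<close>
  obtain i' j' where i'j': "upair i j = upair i' j'" "i' < n" "j' < n" "i' \<noteq> j'" "k \<noteq> j'" "l \<noteq> j'"
  proof (cases "j \<in> {k, l}")
    case True
    then have "k \<noteq> i" "l \<noteq> i" using ne ij kl by auto
    with that[of j i] ij show ?thesis by (simp add: upair_commute)
  next
    case False
    with that[of i j] ij show ?thesis by auto
  qed
  let ?P = "\<lambda>J. Pi\<^sub>M J (\<lambda>_. lborel :: real measure)"
  define F where "F = (\<lambda>x. if psd_mat n (corr_of_coords n x)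
                 then w (Determinant.det (corr_of_coords n x)) else 0)"
  have F [measurable]: "F \<in> borel_measurable (?P (offdiag n))"
    unfolding F_def
    using corr_of_coords_psd_measurable[of n] corr_of_coords_det_measurable[of n]
    unfolding coords_lborel_def by (intro measurable_If) auto
  define K where "K = offdiag n - {upair i j}"
  define J where "J = {p \<in> K. fst p = j' \<or> snd p = j'}"
  \<comment> \<open>Jacobian times weight factor at s = sqrt (1 - a^2), extended by 0 where no
    correlation matrix exists.\<close>
  define g where "g a = (if \<bar>a\<bar> < 1 then
      ennreal (sqrt (1 - a\<^sup>2) ^ card J) * h (sqrt (1 - a\<^sup>2)) else 0)" for a :: real
  have [measurable]: "g \<in> borel_measurable borel" unfolding g_def by measurable
  define H where "H B = (\<integral>\<^sup>+ x. F (x(upair i j := 0)) * indicator B (x (upair k l)) \<partial>?P K)" for B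
  define G where "G A = (\<integral>\<^sup>+ a. g a * indicator A a \<partial>lborel)" for A
  have e: "insert (upair i j) K = offdiag n" "finite K" "upair i j \<notin> K"
    using upair_in_offdiag[OF ij(3,1,2)] by (auto simp: K_def)
  have "upair k l \<noteq> upair i j" using ne by (auto simp: upair_eq_iff)
  then have kl_K: "upair k l \<in> K" using upair_in_offdiag[OF kl(3,1,2)] by (simp add: K_def)
  show thesis
  proof (rule that)
    fix A B :: "real set" assume [measurable]: "A \<in> sets borel" "B \<in> sets borel"
    let ?f = "\<lambda>x. F x * (indicator A (x (upair i j)) * indicator B (x (upair k l)))"
    have [measurable]: "(\<lambda>x. x(upair i j := t)) \<in> ?P K \<rightarrow>\<^sub>M ?P (offdiag n)" for t
      unfolding e(1)[symmetric] by measurable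
    have "(\<integral>\<^sup>+ x. (if psd_mat n (corr_of_coords n x) then
           w (Determinant.det (corr_of_coords n x)) *
           (indicator A (x (upair i j)) * indicator B (x (upair k l))) else 0) \<partial>coords_lborel n) =
        (\<integral>\<^sup>+ x. ?f x \<partial>?P (insert (upair i j) K))"
      unfolding e(1) coords_lborel_def by (intro nn_integral_cong) (simp add: F_def)
    also have "\<dots> = (\<integral>\<^sup>+ a. \<integral>\<^sup>+ x. ?f (x(upair i j := a)) \<partial>?P K \<partial>lborel)"
      using upair_in_offdiag[OF ij(3,1,2)] upair_in_offdiag[OF kl(3,1,2)]
      by (intro lborel_PiM.product_nn_integral_insert_rev e) (unfold e(1), measurable)
    also have "\<dots> = (\<integral>\<^sup>+ a. (g a * indicator A a) * H B \<partial>lborel)"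
    proof (rule nn_integral_cong_AE)
      \<comment> \<open>At a = 1 and a = -1 the shear is singular because s = 0; these two slices
        are null.\<close>
      have "AE a in lborel. a \<noteq> (1::real)" "AE a in lborel. a \<noteq> (- 1::real)"
        by (rule AE_lborel_singleton)+
      then show "AE a in lborel. (\<integral>\<^sup>+ x. ?f (x(upair i j := a)) \<partial>?P K) = (g a * indicator A a) * H B"
      proof eventually_elim
        fix a :: real assume "a \<noteq> 1" "a \<noteq> - 1"
        have "(\<integral>\<^sup>+ x. ?f (x(upair i j := a)) \<partial>?P K) =
            (\<integral>\<^sup>+ x. indicator A a * (F (x(upair i j := a)) * indicator B (x (upair k l))) \<partial>?P K)"
          using \<open>upair k l \<noteq> upair i j\<close> by (intro nn_integral_cong) (simp add: mult_ac)
        also have "\<dots> = indicator A a * (\<integral>\<^sup>+ x. F (x(upair i j := a)) * indicator B (x (upair k l)) \<partial>?P K)"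
          using kl_K by (intro nn_integral_cmult) measurable
        also have "(\<integral>\<^sup>+ x. F (x(upair i j := a)) * indicator B (x (upair k l)) \<partial>?P K) = g a * H B"
        proof (cases "\<bar>a\<bar> < 1")
          case True
          define s where "s = sqrt (1 - a\<^sup>2)"
          have "a\<^sup>2 < 1" using True by (simp add: abs_square_less_1)
          then have s: "s > 0" "s\<^sup>2 = 1 - a\<^sup>2" by (simp_all add: s_def)
          show ?thesis
            using nn_integral_corr_row_shear[where s = s and a = a and w = w and h = h,
                OF i'j'(2-4) kl i'j'(5,6) s w_scale[OF s(1)] F_def F, of B]
              True
            by (simp add: g_def H_def J_def K_def s_def i'j'(1))
        next
          case False
          then have "\<bar>a\<bar> > 1" using \<open>a \<noteq> 1\<close> \<open>a \<noteq> - 1\<close> by linarith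
          then have "F (x(upair i j := a)) = 0" for x
            using psd_mat_corr_entry_bound[OF _ ij, of "x(upair i j := a)"] by (auto simp: F_def)
          then show ?thesis using False by (simp add: g_def)
        qed
        finally show "(\<integral>\<^sup>+ x. ?f (x(upair i j := a)) \<partial>?P K) = (g a * indicator A a) * H B"
          by (simp only: mult_ac)
      qed
    qed
    also have "\<dots> = G A * H B"
      unfolding G_def by (intro nn_integral_multc) measurable
    finally show "(\<integral>\<^sup>+ x. (if psd_mat n (corr_of_coords n x) then
           w (Determinant.det (corr_of_coords n x)) *
           (indicator A (x (upair i j)) * indicator B (x (upair k l))) else 0) \<partial>coords_lborel n) = G A * H B" .
  qed
qed

subsection \<open>Independence\<close>

lemma borel_measurable_corr_lborel:
  assumes "(\<lambda>x. f (corr_of_coords n x)) \<in> borel_measurable (coords_lborel n)"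
  shows "f \<in> borel_measurable (corr_lborel n)"
  unfolding corr_lborel_def
  by (intro measurable_embed_measure1 measurable_restrict_space1 assms)

text \<open>Injectivity of the coordinate map moves the integral back to coordinates, and the
  restriction to correlation matrices becomes the case distinction.\<close>

lemma nn_integral_corr_lborel:
  assumes "f \<in> borel_measurable (corr_lborel n)"
  shows "(\<integral>\<^sup>+ C. f C \<partial>corr_lborel n) =
    (\<integral>\<^sup>+ x. (if psd_mat n (corr_of_coords n x) then f (corr_of_coords n x) else 0) \<partial>coords_lborel n)"
proof -
  let ?E = "{x. corr_of_coords n x \<in> corr_mats n}"
  have inj: "inj_on (corr_of_coords n) (space (restrict_space (coords_lborel n) ?E))"
    by (rule inj_on_subset[OF inj_on_corr_of_coords]) (auto simp: space_restrict_space)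
  have E: "?E \<inter> space (coords_lborel n) \<in> sets (coords_lborel n)"
    using corr_of_coords_psd_measurable[of n]
    by (simp add: corr_of_coords_in_corr_mats_iff Int_def conj_commute)
  have "(\<integral>\<^sup>+ C. f C \<partial>corr_lborel n) = (\<integral>\<^sup>+ x. f (corr_of_coords n x) * indicator ?E x \<partial>coords_lborel n)"
    using nn_integral_embed_measure'[OF inj assms[unfolded corr_lborel_def]]
    by (simp add: corr_lborel_def nn_integral_restrict_space[OF E])
  also have "\<dots> = (\<integral>\<^sup>+ x. (if psd_mat n (corr_of_coords n x) then f (corr_of_coords n x) else 0) \<partial>coords_lborel n)"
    by (intro nn_integral_cong) (simp add: corr_of_coords_in_corr_mats_iff)
  finally show ?thesis .
qed

text \<open>A general weight $w$ covers the uniform law too, which is not literally the case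
  $\eta = 1$, since \<open>0 powr 0 = 0\<close> on singular matrices.\<close>

lemma indep_entries_of_density:
  fixes w h :: "real \<Rightarrow> ennreal"
  assumes ij: "i < n" "j < n" "i \<noteq> j" and kl: "k < n" "l < n" "k \<noteq> l" and ne: "{i, j} \<noteq> {k, l}"
    and [measurable]: "w \<in> borel_measurable borel" "h \<in> borel_measurable borel"
    and w_scale: "\<And>s d. s > 0 \<Longrightarrow> w (s\<^sup>2 * d) = h s * w d"
    and "prob_space P" and C [measurable]: "C \<in> measurable P (corr_lborel n)"
    and distr: "distr P (corr_lborel n) C = density (corr_lborel n) (\<lambda>C. w (Determinant.det C) / Z)"
  shows "prob_space.indep_var P borel (\<lambda>\<omega>. C \<omega> $$ (i, j)) borel (\<lambda>\<omega>. C \<omega> $$ (k, l))"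
proof -
  interpret prob_space P by fact
  obtain G H :: "real set \<Rightarrow> ennreal" where GH: "\<And>A B. A \<in> sets borel \<Longrightarrow> B \<in> sets borel \<Longrightarrow>
      (\<integral>\<^sup>+ x. (if psd_mat n (corr_of_coords n x) then
           w (Determinant.det (corr_of_coords n x)) *
           (indicator A (x (upair i j)) * indicator B (x (upair k l))) else 0) \<partial>coords_lborel n) = G A * H B"
    by (rule nn_integral_corr_factorization[OF ij kl ne assms(8,9)], rule w_scale, assumption, erule that)
  let ?L = "corr_lborel n"
  have entry [measurable]: "(\<lambda>C. C $$ (u, v)) \<in> borel_measurable ?L" if "u < n" "v < n" for u v
    using corr_of_coords_entry_measurable[OF that] by (rule borel_measurable_corr_lborel)
  note [measurable] = entry[OF ij(1,2)] entry[OF kl(1,2)]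
  have [measurable]: "Determinant.det \<in> borel_measurable ?L"
    using corr_of_coords_det_measurable by (rule borel_measurable_corr_lborel)
  let ?X = "\<lambda>\<omega>. C \<omega> $$ (i, j)" and ?Y = "\<lambda>\<omega>. C \<omega> $$ (k, l)"
  have joint: "emeasure P {\<omega> \<in> space P. ?X \<omega> \<in> A \<and> ?Y \<omega> \<in> B} = G A * H B / Z"
    if [measurable]: "A \<in> sets borel" "B \<in> sets borel" for A B
  proof -
    let ?S = "{C \<in> space ?L. C $$ (i, j) \<in> A \<and> C $$ (k, l) \<in> B}"
    have S: "?S \<in> sets ?L" by measurable
    have "{\<omega> \<in> space P. ?X \<omega> \<in> A \<and> ?Y \<omega> \<in> B} = C -` ?S \<inter> space P"
      using measurable_space[OF C] by auto
    then have "emeasure P {\<omega> \<in> space P. ?X \<omega> \<in> A \<and> ?Y \<omega> \<in> B} = emeasure (distr P ?L C) ?S"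
      using S C by (simp add: emeasure_distr)
    also have "\<dots> = (\<integral>\<^sup>+ C. w (Determinant.det C) / Z * indicator ?S C \<partial>?L)"
      unfolding distr using S by (intro emeasure_density) measurable
    also have "\<dots> = (\<integral>\<^sup>+ C. w (Determinant.det C) *
        (indicator A (C $$ (i, j)) * indicator B (C $$ (k, l))) / Z \<partial>?L)"
      by (intro nn_integral_cong) (simp add: indicator_def)
    also have "\<dots> = (\<integral>\<^sup>+ C. w (Determinant.det C) *
        (indicator A (C $$ (i, j)) * indicator B (C $$ (k, l))) \<partial>?L) / Z"
      by (intro nn_integral_divide) measurable
    also have "\<dots> = G A * H B / Z"
      using ij kl GH[OF that] by (subst nn_integral_corr_lborel) (simp_all add: corr_of_coords_index cong: if_cong)
    finally show ?thesis .
  qed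
  \<comment> \<open>The only fact used about \<open>Z\<close>: the whole space has probability
    1.\<close>
  have total: "G UNIV * H UNIV / Z = 1"
    using joint[of UNIV UNIV] emeasure_space_1 by simp
  have [measurable]: "random_variable borel ?X" "random_variable borel ?Y"
    by measurable
  \<comment> \<open>Independence means that the joint law is the product of the marginals; by
    sigma-finiteness it suffices to compare rectangles.\<close>
  show ?thesis
    unfolding indep_var_distribution_eq
  proof (intro conjI pair_measure_eqI)
    show "sigma_finite_measure (distr P borel ?X)" "sigma_finite_measure (distr P borel ?Y)"
      by (intro prob_space_imp_sigma_finite prob_space_distr; measurable)+
    fix A B assume "A \<in> sets (distr P borel ?X)" "B \<in> sets (distr P borel ?Y)"
    then have AB [measurable]: "A \<in> sets borel" "B \<in> sets borel" by auto
    have "emeasure (distr P borel ?X) A = G A * H UNIV / Z"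
      using joint[OF AB(1), of UNIV] by (simp add: emeasure_distr vimage_def Int_def conj_commute)
    moreover have "emeasure (distr P borel ?Y) B = G UNIV * H B / Z"
      using joint[OF _ AB(2), of UNIV] by (simp add: emeasure_distr vimage_def Int_def conj_commute)
    moreover have "emeasure (distr P (borel \<Otimes>\<^sub>M borel) (\<lambda>\<omega>. (?X \<omega>, ?Y \<omega>))) (A \<times> B) = G A * H B / Z"
      using joint[OF AB] by (simp add: emeasure_distr vimage_def Int_def conj_commute conj_assoc)
    \<comment> \<open>Regrouping the factors turns the product of the marginals into the joint mass
      times \<open>G UNIV * H UNIV / Z\<close>, which is 1 by \<open>total\<close>.\<close>
    moreover have "G A * H UNIV / Z * (G UNIV * H B / Z) = G A * H B / Z * (G UNIV * H UNIV / Z)"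
      by (simp add: divide_ennreal_def mult_ac)
    ultimately show "emeasure (distr P borel ?X) A * emeasure (distr P borel ?Y) B =
        emeasure (distr P (borel \<Otimes>\<^sub>M borel) (\<lambda>\<omega>. (?X \<omega>, ?Y \<omega>))) (A \<times> B)"
      by (simp add: total)
  next
    show "sets (distr P borel ?X \<Otimes>\<^sub>M distr P borel ?Y) =
        sets (distr P (borel \<Otimes>\<^sub>M borel) (\<lambda>\<omega>. (?X \<omega>, ?Y \<omega>)))"
      unfolding sets_distr by (rule sets_pair_measure_cong) (rule sets_distr)+
  qed fact+
qed

theorem lemma1:
  fixes n i j k l :: nat and \<eta> :: real
    and P :: "'a measure" and C :: "'a \<Rightarrow> real mat"
  assumes "\<eta> > 0"
    and "i < n" and "j < n" and "k < n" and "l < n"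
    and "i \<noteq> j" and "k \<noteq> l" and "{i, j} \<noteq> {k, l}"
    and "prob_space P" and "C \<in> measurable P (corr_lborel n)"
  shows "(distr P (corr_lborel n) C = LKJ n \<eta> \<longrightarrow>
            prob_space.indep_var P borel (\<lambda>\<omega>. C \<omega> $$ (i, j)) borel (\<lambda>\<omega>. C \<omega> $$ (k, l))) \<and>
         (distr P (corr_lborel n) C = corr_uniform n \<longrightarrow>
            prob_space.indep_var P borel (\<lambda>\<omega>. C \<omega> $$ (i, j)) borel (\<lambda>\<omega>. C \<omega> $$ (k, l)))"
proof (intro conjI impI)
  note indep = indep_entries_of_density[OF assms(2,3,6,4,5,7,8) _ _ _ assms(9,10)]
  {
    assume "distr P (corr_lborel n) C = LKJ n \<eta>"
    \<comment> \<open>The scaling law for this weight is multiplicativity of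
      \<open>powr\<close>.\<close>
    then show "prob_space.indep_var P borel (\<lambda>\<omega>. C \<omega> $$ (i, j)) borel (\<lambda>\<omega>. C \<omega> $$ (k, l))"
      unfolding LKJ_def
      by (intro indep[where w = "\<lambda>d. ennreal (d powr (\<eta> - 1))"
            and h = "\<lambda>s. ennreal ((s\<^sup>2) powr (\<eta> - 1))"])
        (auto simp: powr_mult ennreal_mult)
  }
  {
    assume "distr P (corr_lborel n) C = corr_uniform n"
    \<comment> \<open>The indicator in the uniform density is constantly 1, because
      \<open>corr_mats n\<close> is the whole space; the weight is therefore constant.\<close>
    moreover have "corr_uniform n = density (corr_lborel n) (\<lambda>C. 1 / emeasure (corr_lborel n) (corr_mats n))"
    proof -
      have L: "corr_mats n \<in> sets (corr_lborel n)"
        using sets.top[of "corr_lborel n"] by (simp add: space_corr_lborel)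
      show ?thesis
        unfolding corr_uniform_def uniform_measure_def
        by (rule density_cong) (use L in \<open>auto simp: space_corr_lborel\<close>)
    qed
    ultimately show "prob_space.indep_var P borel (\<lambda>\<omega>. C \<omega> $$ (i, j)) borel (\<lambda>\<omega>. C \<omega> $$ (k, l))"
      by (intro indep[where w = "\<lambda>_. 1" and h = "\<lambda>_. 1"]) auto
  }
qed

end
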